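(* Let $d\ge 2$ and let $\phi:\mathbb{R}\to\mathbb{R}$ be such that, for the tensor-product kernel $$\psi(\mathbf{y})=\prod_{i=1}^d \phi(y_i),\qquad \mathbf{y}=(y_1,\dots,y_d)\in\mathbb{R}^d,$$ the interpolation problem defining $S_{A_{\mathbf{l}}}$ on $\mathbb{X}_{\mathbf{l}}$ is uniquely solvable for every $\mathbf{l}\in\mathbb{N}^d$ (that is, for every $u:[0,1]^d\to\mathbb{R}$ there is exactly one choice of coefficients $c_{\mathbf{l},\mathbf{i}}$ satisfying the interpolation conditions). Then sparse kernel-based interpolation (SKI) with the kernel $\psi$ is an interpolatory scheme: for every $n\in\mathbb{N}$ and every function $u:[0,1]^d\to\mathbb{R}$, the sparse kernel-based interpolant $\tilde S_{n,d}$ of $u$ satisfies $$\tilde S_{n,d}(\mathbf{x})=u(\mathbf{x})\qquad\text{for all } \mathbf{x}\in\tilde{\mathbb{X}}^{n,d}.$$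
   Context: Here $\mathbb{N}=\{1,2,3,\dots\}$ and $\Omega=[0,1]^d$. For a multi-index $\mathbf{l}=(l_1,\dots,l_d)\in\mathbb{N}^d$ put $|\mathbf{l}|_1=l_1+\dots+l_d$. Grids: $\mathbb{X}_{\mathbf{l}}\subset\Omega$ is the directionally uniform grid consisting of the points $\mathbf{x}_{\mathbf{l},\mathbf{i}}=(x_{l_1,i_1},\dots,x_{l_d,i_d})$ with $x_{l_j,i_j}=i_j2^{-l_j}$, $i_j=0,1,\dots,2^{l_j}$, $j=1,\dots,d$. The sparse grid of level $n$ in $d$ dimensions is $$\tilde{\mathbb{X}}^{n,d}=\bigcup_{\mathbf{l}\in\mathbb{N}^d,\ |\mathbf{l}|_1=n+(d-1)}\mathbb{X}_{\mathbf{l}}.$$ Sub-grid interpolants: let $A_{\mathbf{l}}=\mathrm{diag}(2^{l_1},\dots,2^{l_d})$. For $u:\Omega\to\mathbb{R}$ and a kernel $\psi:\mathbb{R}^d\to\mathbb{R}$, the anisotropic kernel interpolant of $u$ on $\mathbb{X}_{\mathbf{l}}$ is $$S_{A_{\mathbf{l}}}(\mathbf{x})=\sum_{\mathbf{x}_{\mathbf{l},\mathbf{i}}\in\mathbb{X}_{\mathbf{l}}}c_{\mathbf{l},\mathbf{i}}\,\psi\big(A_{\mathbf{l}}(\mathbf{x}-\mathbf{x}_{\mathbf{l},\mathbf{i}})\big),\qquad \mathbf{x}\in\Omega,$$ where the coefficients $c_{\mathbf{l},\mathbf{i}}\in\mathbb{R}$ are chosen so that $S_{A_{\mathbf{l}}}(\mathbf{x})=u(\mathbf{x})$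 for all $\mathbf{x}\in\mathbb{X}_{\mathbf{l}}$. Sparse kernel-based interpolant (SKI) of $u$: $$\tilde S_{n,d}(\mathbf{x})=\sum_{q=0}^{d-1}(-1)^q\binom{d-1}{q}\sum_{\mathbf{l}\in\mathbb{N}^d,\ |\mathbf{l}|_1=n+(d-1)-q}S_{A_{\mathbf{l}}}(\mathbf{x}),\qquad \mathbf{x}\in\Omega,$$ where a sum over an empty set of multi-indices is $0$. *)

theory Defs
  imports "HOL-Analysis.Analysis"
begin

text \<open>
  The dimension \<open>d\<close> is \<open>CARD('d)\<close>: points are of type \<open>real ^ 'd\<close>, multi-indices of type
  \<open>nat ^ 'd\<close>. Since HOL's naturals start at 0, \<open>levels m\<close> restricts to positive components.
  Functions on the unit cube \<open>cbox 0 1\<close> are represented by functions on all of \<open>real ^ 'd\<close>;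
  only their values at grid points, which lie in the cube, are ever used.
\<close>

definition levels :: "nat \<Rightarrow> (nat ^ 'd::finite) set" where
  "levels m = {l. (\<forall>j. 1 \<le> l $ j) \<and> (\<Sum>j\<in>UNIV. l $ j) = m}"

definition grid_index :: "nat ^ 'd::finite \<Rightarrow> (nat ^ 'd) set" where
  "grid_index l = {i. \<forall>j. i $ j \<le> 2 ^ (l $ j)}"

definition grid_point :: "nat ^ 'd::finite \<Rightarrow> nat ^ 'd \<Rightarrow> real ^ 'd" where
  "grid_point l i = (\<chi> j. real (i $ j) / 2 ^ (l $ j))"

definition grid :: "nat ^ 'd::finite \<Rightarrow> (real ^ 'd) set" where
  "grid l = grid_point l ` grid_index l"

definition sparse_grid :: "nat \<Rightarrow> (real ^ 'd::finite) set" where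
  "sparse_grid n = (\<Union>l\<in>levels (n + (CARD('d) - 1)). grid l)"

definition scale_matrix :: "nat ^ 'd::finite \<Rightarrow> real ^ 'd ^ 'd" where
  "scale_matrix l = (\<chi> i j. if i = j then 2 ^ (l $ i) else 0)"

definition tensor_kernel :: "(real \<Rightarrow> real) \<Rightarrow> real ^ 'd::finite \<Rightarrow> real" where
  "tensor_kernel \<phi> y = (\<Prod>i\<in>UNIV. \<phi> (y $ i))"

definition kernel_sum ::
  "(real ^ 'd::finite \<Rightarrow> real) \<Rightarrow> nat ^ 'd \<Rightarrow> (nat ^ 'd \<Rightarrow> real) \<Rightarrow> real ^ 'd \<Rightarrow> real" where
  "kernel_sum \<psi> l c x =
     (\<Sum>i\<in>grid_index l. c i * \<psi> (scale_matrix l *v (x - grid_point l i)))"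

text \<open>
  Coefficient families live on the finite set \<open>grid_index l\<close>; requiring them to be extensional
  makes ``exactly one choice of coefficients'' a statement about equality of HOL functions.
\<close>

definition interp_coeffs ::
  "(real ^ 'd::finite \<Rightarrow> real) \<Rightarrow> nat ^ 'd \<Rightarrow> (real ^ 'd \<Rightarrow> real) \<Rightarrow> (nat ^ 'd \<Rightarrow> real) \<Rightarrow> bool" where
  "interp_coeffs \<psi> l u c \<longleftrightarrow>
     c \<in> extensional (grid_index l) \<and> (\<forall>x\<in>grid l. kernel_sum \<psi> l c x = u x)"

definition uniquely_solvable :: "(real ^ 'd::finite \<Rightarrow> real) \<Rightarrow> nat ^ 'd \<Rightarrow> bool" where
  "uniquely_solvable \<psi> l \<longleftrightarrow> (\<forall>u. \<exists>!c. interp_coeffs \<psi> l u c)"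

definition kernel_interpolant ::
  "(real ^ 'd::finite \<Rightarrow> real) \<Rightarrow> nat ^ 'd \<Rightarrow> (real ^ 'd \<Rightarrow> real) \<Rightarrow> real ^ 'd \<Rightarrow> real" where
  "kernel_interpolant \<psi> l u = kernel_sum \<psi> l (THE c. interp_coeffs \<psi> l u c)"

definition sparse_kernel_interpolant ::
  "(real ^ 'd::finite \<Rightarrow> real) \<Rightarrow> nat \<Rightarrow> (real ^ 'd \<Rightarrow> real) \<Rightarrow> real ^ 'd \<Rightarrow> real" where
  "sparse_kernel_interpolant \<psi> n u x =
     (\<Sum>q = 0..CARD('d) - 1. (-1) ^ q * real ((CARD('d) - 1) choose q) *
        (\<Sum>l\<in>levels (n + (CARD('d) - 1) - q). kernel_interpolant \<psi> l u x))"

lemma finite_vec_le: "finite {i :: nat ^ 'd::finite. \<forall>j. i $ j \<le> b j}"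
proof -
  have "{i :: nat ^ 'd. \<forall>j. i $ j \<le> b j} \<subseteq> vec_lambda ` (PiE UNIV (\<lambda>j. {..b j}))"
  proof
    fix i :: "nat ^ 'd"
    assume "i \<in> {i. \<forall>j. i $ j \<le> b j}"
    then have "(\<lambda>j. i $ j) \<in> PiE UNIV (\<lambda>j. {..b j})" by auto
    then have "vec_lambda (\<lambda>j. i $ j) \<in> vec_lambda ` (PiE UNIV (\<lambda>j. {..b j}))"
      by (rule imageI)
    then show "i \<in> vec_lambda ` (PiE UNIV (\<lambda>j. {..b j}))" by simp
  qed
  then show ?thesis by (rule finite_subset) (simp add: finite_PiE)
qed

lemma finite_grid_index: "finite (grid_index l)"
  unfolding grid_index_def by (rule finite_vec_le)

lemma finite_levels: "finite (levels m :: (nat ^ 'd::finite) set)"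
proof (rule finite_subset)
  show "(levels m :: (nat ^ 'd) set) \<subseteq> {i. \<forall>j. i $ j \<le> m}"
    unfolding levels_def by (auto intro: member_le_sum)
  show "finite {i :: nat ^ 'd. \<forall>j. i $ j \<le> m}" by (rule finite_vec_le)
qed

lemma inj_grid_point: "inj (grid_point l)"
  by (auto simp: inj_def grid_point_def vec_eq_iff)

lemma grid_subset_unit_cube: "grid l \<subseteq> cbox 0 1"
proof -
  have "real k / 2 ^ m \<le> 1" if "k \<le> 2 ^ m" for k m :: nat
    using of_nat_mono[OF that, where 'a = real] by simp
  then show ?thesis
    by (auto simp: grid_def grid_index_def grid_point_def mem_box_cart)
qed

lemma scale_matrix_mult: "scale_matrix l *v y = (\<chi> j. 2 ^ (l $ j) * y $ j)"
  by (simp add: scale_matrix_def matrix_vector_mult_def vec_eq_iff if_distrib if_distribR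
      cong: if_cong)

lemma kernel_interpolant_interpolates:
  assumes "uniquely_solvable \<psi> l" and "x \<in> grid l"
  shows "kernel_interpolant \<psi> l u x = u x"
  using theI'[of "interp_coeffs \<psi> l u"] assms
  by (auto simp: uniquely_solvable_def interp_coeffs_def kernel_interpolant_def)

end

theory Submission
  imports Defs "HOL-Computational_Algebra.Formal_Power_Series"
begin

text \<open>
  The proof separates a property of the sub-grid interpolants from a counting identity.

  For a product kernel, each sub-grid interpolant is a tensor product of one-dimensional ones:
  slicing the interpolant of the indicator of a grid point along a coordinate line yields
  one-dimensional cardinal functions (lemma \<open>cardinal_coefficients_exist\<close>), and by uniqueness the
  interpolant on \<open>grid l\<close> is \<open>\<Sum>p\<in>grid l. u p * (\<Prod>j. L\<^sub>j (x $ j))\<close>, where \<open>L\<^sub>j\<close> is the level-\<open>l $ j\<close>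
  cardinal function of the node \<open>p $ j\<close> (lemma \<open>kernel_interpolant_cardinal\<close>). Let now \<open>x\<close> lie in
  \<open>grid k\<close>. Raising \<open>l $ j\<close> beyond \<open>k $ j\<close> changes nothing at \<open>x\<close>, since \<open>x $ j\<close> is then a node of
  level \<open>l $ j\<close> and the factor in direction \<open>j\<close> just picks the nodes \<open>p\<close> with \<open>p $ j = x $ j\<close>. So
  the value at \<open>x\<close> depends on \<open>l\<close> only through the componentwise minimum of \<open>l\<close> and \<open>k\<close> (lemma
  \<open>kernel_interpolant_truncate\<close>).

  For any function \<open>F\<close> of the level with this property, the alternating sum of the combination
  technique over \<open>\<bar>l\<bar>\<^sub>1 = m - q\<close>, where \<open>m = \<bar>k\<bar>\<^sub>1\<close>, collapses to \<open>F k\<close> (lemma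
  \<open>combination_sum_truncated\<close>). It is the coefficient of \<open>X^m\<close> in \<open>(1 - X)^(d - 1)\<close> times the
  generating function of \<open>F\<close>. The levels truncated to a given \<open>p\<close> have the generating function
  \<open>X^\<bar>p\<bar>\<^sub>1 / (1 - X)^r\<close>, with \<open>r\<close> the number of coordinates where \<open>p\<close> and \<open>k\<close> agree. For \<open>p = k\<close> the
  coefficient is \<open>1\<close>. Otherwise the product is a polynomial of degree
  \<open>\<bar>p\<bar>\<^sub>1 + d - 1 - r < \<bar>k\<bar>\<^sub>1 = m\<close>, as \<open>p\<close> is smaller than \<open>k\<close> in \<open>d - r\<close> coordinates, and the
  coefficient vanishes. Finally \<open>F k = u x\<close>, because the interpolant on \<open>grid k\<close> reproduces \<open>u\<close> at
  the node \<open>x\<close>.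
\<close>

section \<open>Products over coordinates\<close>

lemma sum_vec_prod:
  fixes f :: "'d::finite \<Rightarrow> 'a \<Rightarrow> 'c::comm_semiring_1"
  assumes "\<And>j. finite (B j)"
  shows "(\<Sum>p\<in>{p :: 'a ^ 'd. \<forall>j. p $ j \<in> B j}. \<Prod>j\<in>UNIV. f j (p $ j))
    = (\<Prod>j\<in>UNIV. \<Sum>y\<in>B j. f j y)"
proof -
  have "(\<Sum>p\<in>{p :: 'a ^ 'd. \<forall>j. p $ j \<in> B j}. \<Prod>j\<in>UNIV. f j (p $ j))
      = (\<Sum>g\<in>PiE UNIV B. \<Prod>j\<in>UNIV. f j (g j))"
    by (rule sum.reindex_bij_witness[of _ vec_lambda vec_nth]) (auto simp: PiE_def)
  then show ?thesis
    using assms by (simp add: prod_sum_PiE)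
qed

lemma prod_of_bool:
  assumes "finite A"
  shows "(\<Prod>j\<in>A. of_bool (P j)) = (of_bool (\<forall>j\<in>A. P j) :: 'c::comm_semiring_1)"
  using assms by (induction A) auto

section \<open>The combination technique on truncated functions\<close>

text \<open>The Cauchy product of finitely many power series, with exponents collected in vectors.\<close>

lemma fps_nth_prod_vec:
  fixes f :: "'d::finite \<Rightarrow> 'c::comm_ring_1 fps"
  shows "fps_nth (\<Prod>j\<in>UNIV. f j) s
    = (\<Sum>l\<in>{l :: nat ^ 'd. (\<Sum>j\<in>UNIV. l $ j) = s}. \<Prod>j\<in>UNIV. fps_nth (f j) (l $ j))"
proof -
  have count: "count (Abs_multiset (vec_nth l)) j = l $ j" for l :: "nat ^ 'd" and j
    by (subst Abs_multiset_inverse) auto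
  have inv: "Abs_multiset (vec_nth (\<chi> j. count M j)) = M" for M :: "'d multiset"
    by (rule multiset_eqI) (simp add: count)
  have size: "size M = (\<Sum>j\<in>UNIV. count M j)" for M :: "'d multiset"
    by (simp add: size_multiset_overloaded_eq sum.mono_neutral_left not_in_iff)
  show ?thesis
    unfolding fps_prod_nth'[OF finite]
    by (rule sum.reindex_bij_witness
        [of _ "\<lambda>l. Abs_multiset (vec_nth l)" "\<lambda>M. \<chi> j. count M j"])
      (auto simp: multisets_of_size_def count size inv vec_eq_iff)
qed

lemma fps_nth_one_minus_X_power:
  "fps_nth ((1 - fps_X) ^ e) q = ((-1) ^ q * of_nat (e choose q) :: 'c::comm_ring_1)"
proof -
  have "(1 - fps_X :: 'c fps) ^ e = (- fps_X + 1) ^ e"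
    by simp
  also have "\<dots> = (\<Sum>k\<le>e. fps_const ((-1) ^ k * of_nat (e choose k)) * fps_X ^ k)"
    unfolding binomial_ring
    by (intro sum.cong refl)
      (simp add: power_minus[of fps_X] fps_const_power[symmetric] fps_of_nat[symmetric]
        fps_const_neg[symmetric] fps_const_mult[symmetric] algebra_simps
        del: fps_const_neg fps_const_mult fps_const_power)
  finally show ?thesis
    by (simp add: fps_sum_nth sum.delta if_distrib binomial_eq_0 cong: if_cong)
qed

text \<open>
  The generating function of the one-dimensional levels that truncation at \<open>k\<close> sends to \<open>p\<close>:
  a single level for \<open>p < k\<close>, all levels from \<open>k\<close> on for \<open>p = k\<close>.
\<close>

definition truncation_fps :: "nat \<Rightarrow> nat \<Rightarrow> real fps" where
  "truncation_fps k p = Abs_fps (\<lambda>t. of_bool (1 \<le> t \<and> min t k = p))"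

lemma truncation_fps_less: "1 \<le> p \<Longrightarrow> p < k \<Longrightarrow> truncation_fps k p = fps_X ^ p"
  by (rule fps_ext) (auto simp: truncation_fps_def min_def)

lemma truncation_fps_same:
  "1 \<le> k \<Longrightarrow> truncation_fps k k = fps_X ^ k * Abs_fps (\<lambda>_. 1)"
  by (rule fps_ext) (auto simp: truncation_fps_def fps_X_power_mult_nth min_def)

lemma fps_nth_prod_truncation_fps:
  fixes k p :: "nat ^ 'd::finite"
  shows "fps_nth (\<Prod>j\<in>UNIV. truncation_fps (k $ j) (p $ j)) s
    = (\<Sum>l\<in>levels s. of_bool ((\<chi> j. min (l $ j) (k $ j)) = p))"
proof -
  let ?A = "{l :: nat ^ 'd. (\<Sum>j\<in>UNIV. l $ j) = s}"
  have fin: "finite ?A"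
  proof (rule finite_subset)
    show "?A \<subseteq> {l. \<forall>j. l $ j \<le> s}"
      by (auto intro: member_le_sum)
  qed (rule finite_vec_le)
  have "fps_nth (\<Prod>j\<in>UNIV. truncation_fps (k $ j) (p $ j)) s
      = (\<Sum>l\<in>?A. of_bool (\<forall>j. 1 \<le> l $ j \<and> min (l $ j) (k $ j) = p $ j))"
    by (simp add: fps_nth_prod_vec truncation_fps_def prod_of_bool)
  also have "\<dots> = (\<Sum>l\<in>levels s. of_bool ((\<chi> j. min (l $ j) (k $ j)) = p))"
    by (rule sum.mono_neutral_cong_right[OF fin]) (auto simp: levels_def vec_eq_iff)
  finally show ?thesis .
qed

text \<open>
  With \<open>r\<close> the number of coordinates in which \<open>p\<close> and \<open>k\<close> agree, the product is
  \<open>X^\<bar>p\<bar>\<^sub>1 (1 - X)^(d - 1 - r)\<close>. If \<open>p \<noteq> k\<close>, this is a polynomial of degree less than \<open>\<bar>k\<bar>\<^sub>1\<close>; if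
  \<open>p = k\<close>, it is \<open>X^\<bar>k\<bar>\<^sub>1 / (1 - X)\<close>.
\<close>

lemma fps_nth_combination_truncation_fps:
  fixes k p :: "nat ^ 'd::finite"
  assumes k: "k \<in> levels m" and p: "\<And>j. 1 \<le> p $ j" "\<And>j. p $ j \<le> k $ j"
  shows "fps_nth ((1 - fps_X) ^ (CARD('d) - 1) * (\<Prod>j\<in>UNIV. truncation_fps (k $ j) (p $ j))) m
    = of_bool (p = k)"
proof -
  define g :: "real fps" where "g = Abs_fps (\<lambda>_. 1)"
  define r where "r = card {j. p $ j = k $ j}"
  define P where "P = (\<Sum>j\<in>UNIV. p $ j)"
  have geom: "(1 - fps_X) * g = 1"
  proof -
    have "inverse g * g = 1"
      by (rule inverse_mult_eq_1) (simp add: g_def)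
    then show ?thesis
      by (simp add: g_def fps_inverse_gp')
  qed
  have "truncation_fps (k $ j) (p $ j) = fps_X ^ (p $ j) * (if p $ j = k $ j then g else 1)" for j
    using p[of j] truncation_fps_less[of "p $ j" "k $ j"] truncation_fps_same[of "k $ j"]
    by (auto simp: g_def)
  then have prod: "(\<Prod>j\<in>UNIV. truncation_fps (k $ j) (p $ j)) = fps_X ^ P * g ^ r"
    by (simp add: prod.distrib P_def r_def power_sum prod.If_cases)
  have m: "m = (\<Sum>j\<in>UNIV. k $ j)"
    using k by (simp add: levels_def)
  show ?thesis
  proof (cases "p = k")
    case True
    then have r: "r = Suc (CARD('d) - 1)" and "P = m"
      by (simp_all add: r_def P_def m)
    have "(1 - fps_X) ^ (CARD('d) - 1) * (fps_X ^ P * g ^ r)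
        = fps_X ^ m * (((1 - fps_X) * g) ^ (CARD('d) - 1) * g)"
      unfolding r \<open>P = m\<close> power_mult_distrib power_Suc by (simp only: mult_ac)
    also have "\<dots> = fps_X ^ m * g"
      by (simp add: geom)
    finally have eq: "(1 - fps_X) ^ (CARD('d) - 1) * (fps_X ^ P * g ^ r) = fps_X ^ m * g" .
    have "fps_nth (fps_X ^ m * g) m = 1"
      by (simp add: fps_X_power_mult_nth g_def)
    then show ?thesis
      unfolding prod eq by (simp add: True)
  next
    case False
    have card: "card {j. p $ j \<noteq> k $ j} + r = CARD('d)"
    proof -
      have "card ({j. p $ j \<noteq> k $ j} \<union> {j. p $ j = k $ j}) = card {j. p $ j \<noteq> k $ j} + r"
        unfolding r_def by (rule card_Un_disjoint) auto
      moreover have "{j. p $ j \<noteq> k $ j} \<union> {j. p $ j = k $ j} = UNIV"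
        by auto
      ultimately show ?thesis by simp
    qed
    have "card {j. p $ j \<noteq> k $ j} > 0"
      using False by (auto simp: card_gt_0_iff vec_eq_iff)
    then obtain e where "card {j. p $ j \<noteq> k $ j} = Suc e"
      using gr0_implies_Suc by blast
    with card have e: "CARD('d) - 1 = e + r" "card {j. p $ j \<noteq> k $ j} = Suc e"
      by simp_all
    have "P + card {j. p $ j \<noteq> k $ j} = (\<Sum>j\<in>UNIV. p $ j + of_bool (p $ j \<noteq> k $ j))"
      by (simp add: P_def sum.distrib)
    also have "\<dots> \<le> m"
      unfolding m
    proof (rule sum_mono)
      show "p $ j + of_bool (p $ j \<noteq> k $ j) \<le> k $ j" for j
        using p(2)[of j] by (cases "p $ j = k $ j") simp_all
    qed
    finally have deg: "P + Suc e \<le> m"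
      by (simp add: e)
    have "(1 - fps_X) ^ (CARD('d) - 1) * (fps_X ^ P * g ^ r)
        = fps_X ^ P * ((1 - fps_X) ^ e * ((1 - fps_X) * g) ^ r)"
      unfolding e power_mult_distrib power_add by (simp only: mult_ac)
    also have "\<dots> = fps_X ^ P * (1 - fps_X) ^ e"
      by (simp add: geom)
    finally have eq: "(1 - fps_X) ^ (CARD('d) - 1) * (fps_X ^ P * g ^ r)
        = fps_X ^ P * (1 - fps_X) ^ e" .
    have "fps_nth (fps_X ^ P * (1 - fps_X) ^ e) m = (0 :: real)"
      using deg by (simp add: fps_X_power_mult_nth fps_nth_one_minus_X_power binomial_eq_0)
    then show ?thesis
      unfolding prod eq by (simp add: False)
  qed
qed

text \<open>
  The left-hand side is the coefficient of \<open>X^m\<close> in \<open>(1 - X)^(d - 1)\<close> times the generating function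
  of \<open>F\<close>. Sorting the levels by their truncation \<open>p\<close> reduces it to the previous lemma.
\<close>

lemma combination_sum_truncated:
  fixes F :: "nat ^ 'd::finite \<Rightarrow> real" and k :: "nat ^ 'd"
  assumes k: "k \<in> levels m"
    and F: "\<And>l. (\<forall>j. 1 \<le> l $ j) \<Longrightarrow> F l = F (\<chi> j. min (l $ j) (k $ j))"
  shows "(\<Sum>q = 0..CARD('d) - 1. (-1) ^ q * real ((CARD('d) - 1) choose q) *
      (\<Sum>l\<in>levels (m - q). F l)) = F k"
proof -
  define H where "H = Abs_fps (\<lambda>s. \<Sum>l\<in>levels s. F l)"
  define P where "P = {p :: nat ^ 'd. \<forall>j. 1 \<le> p $ j \<and> p $ j \<le> k $ j}"
  have fin: "finite P"
    by (rule finite_subset[OF _ finite_vec_le[of "vec_nth k"]]) (auto simp: P_def)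
  have kP: "k \<in> P"
    using k by (auto simp: P_def levels_def)
  \<comment> \<open>The sum over \<open>q\<close> thus stays within the Cauchy product, and \<open>m - q\<close> is a true difference.\<close>
  have dim: "CARD('d) - 1 \<le> m"
  proof -
    have "(\<Sum>j\<in>(UNIV :: 'd set). 1) \<le> (\<Sum>j\<in>UNIV. k $ j)"
      by (rule sum_mono) (use k in \<open>auto simp: levels_def\<close>)
    then show ?thesis
      using k by (simp add: levels_def)
  qed
  have H: "H = (\<Sum>p\<in>P. fps_const (F p) * (\<Prod>j\<in>UNIV. truncation_fps (k $ j) (p $ j)))"
  proof (rule fps_ext)
    fix s
    have "F l = (\<Sum>p\<in>P. F p * of_bool ((\<chi> j. min (l $ j) (k $ j)) = p))" if "l \<in> levels s" for l
    proof -
      have "(\<chi> j. min (l $ j) (k $ j)) \<in> P"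
        using that k by (auto simp: P_def levels_def)
      then show ?thesis
        using F[of l] that fin by (simp add: levels_def of_bool_def if_distrib cong: if_cong)
    qed
    then have "fps_nth H s
        = (\<Sum>l\<in>levels s. \<Sum>p\<in>P. F p * of_bool ((\<chi> j. min (l $ j) (k $ j)) = p))"
      by (simp add: H_def)
    also have "\<dots> = (\<Sum>p\<in>P. \<Sum>l\<in>levels s. F p * of_bool ((\<chi> j. min (l $ j) (k $ j)) = p))"
      by (rule sum.swap)
    finally show "fps_nth H s
        = fps_nth (\<Sum>p\<in>P. fps_const (F p) * (\<Prod>j\<in>UNIV. truncation_fps (k $ j) (p $ j))) s"
      by (simp only: fps_sum_nth fps_mult_left_const_nth fps_nth_prod_truncation_fps
          sum_distrib_left)
  qed
  have "(\<Sum>q = 0..CARD('d) - 1. (-1) ^ q * real ((CARD('d) - 1) choose q) *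
      (\<Sum>l\<in>levels (m - q). F l)) = fps_nth ((1 - fps_X) ^ (CARD('d) - 1) * H) m"
    unfolding fps_mult_nth fps_nth_one_minus_X_power H_def fps_nth_Abs_fps
    by (rule sum.mono_neutral_left) (use dim in \<open>auto simp: binomial_eq_0\<close>)
  also have "(1 - fps_X) ^ (CARD('d) - 1) * H = (\<Sum>p\<in>P. fps_const (F p) *
      ((1 - fps_X) ^ (CARD('d) - 1) * (\<Prod>j\<in>UNIV. truncation_fps (k $ j) (p $ j))))"
    unfolding H by (simp add: sum_distrib_left algebra_simps)
  also have "fps_nth \<dots> m = (\<Sum>p\<in>P. F p * of_bool (p = k))"
    unfolding fps_sum_nth fps_mult_left_const_nth
    by (intro sum.cong refl arg_cong2[where f = "(*)"] fps_nth_combination_truncation_fps[OF k])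
      (auto simp: P_def)
  also have "\<dots> = F k"
    using fin kP by (simp add: of_bool_def if_distrib cong: if_cong)
  finally show ?thesis .
qed

section \<open>Sub-grid interpolants as tensor products\<close>

definition dyadic :: "nat \<Rightarrow> real set" where
  "dyadic L = (\<lambda>i. real i / 2 ^ L) ` {..2 ^ L}"

lemma finite_dyadic: "finite (dyadic L)"
  by (simp add: dyadic_def)

lemma zero_in_dyadic: "0 \<in> dyadic L"
  by (force simp: dyadic_def)

lemma dyadic_mono:
  assumes "L \<le> M"
  shows "dyadic L \<subseteq> dyadic M"
proof
  fix t
  assume "t \<in> dyadic L"
  then obtain i where i: "i \<le> 2 ^ L" "t = real i / 2 ^ L"
    by (auto simp: dyadic_def)
  have eq: "(2 :: 'a::comm_semiring_1) ^ M = 2 ^ (M - L) * 2 ^ L"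
    using assms by (simp flip: power_add)
  have "t = real (i * 2 ^ (M - L)) / 2 ^ M"
    by (simp add: i eq)
  moreover have "i * 2 ^ (M - L) \<le> 2 ^ M"
    using i by (simp add: eq mult.commute)
  ultimately show "t \<in> dyadic M"
    unfolding dyadic_def by blast
qed

lemma grid_eq_dyadic: "grid l = {p. \<forall>j. p $ j \<in> dyadic (l $ j)}"
proof (intro equalityI subsetI)
  fix p
  assume "p \<in> {p. \<forall>j. p $ j \<in> dyadic (l $ j)}"
  then have "\<forall>j. \<exists>i. i \<le> 2 ^ (l $ j) \<and> p $ j = real i / 2 ^ (l $ j)"
    by (auto simp: dyadic_def)
  then obtain i where "\<And>j. i j \<le> 2 ^ (l $ j) \<and> p $ j = real (i j) / 2 ^ (l $ j)"
    by metis
  then have "(\<chi> j. i j) \<in> grid_index l" "p = grid_point l (\<chi> j. i j)"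
    by (auto simp: grid_index_def grid_point_def vec_eq_iff)
  then show "p \<in> grid l"
    by (simp add: grid_def)
qed (auto simp: grid_def grid_point_def grid_index_def dyadic_def)

lemma finite_grid: "finite (grid l)"
  by (simp add: grid_def finite_grid_index)

lemma kernel_sum_tensor_kernel:
  "kernel_sum (tensor_kernel \<phi>) l c x
    = (\<Sum>p\<in>grid l. c (inv (grid_point l) p) * (\<Prod>j\<in>UNIV. \<phi> (2 ^ (l $ j) * (x $ j - p $ j))))"
  unfolding grid_def sum.reindex[OF inj_on_subset[OF inj_grid_point subset_UNIV]]
  by (simp add: kernel_sum_def tensor_kernel_def scale_matrix_mult inv_f_f[OF inj_grid_point])

text \<open>The one-dimensional analogue of \<open>kernel_sum\<close>, with coefficients indexed by the nodes.\<close>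

definition kernel_sum_1d :: "(real \<Rightarrow> real) \<Rightarrow> nat \<Rightarrow> (real \<Rightarrow> real) \<Rightarrow> real \<Rightarrow> real" where
  "kernel_sum_1d \<phi> L b s = (\<Sum>y\<in>dyadic L. b y * \<phi> (2 ^ L * (s - y)))"

text \<open>
  On a line parallel to the axis \<open>j\<close>, a sum of tensor kernels is a one-dimensional kernel sum, the
  factors of the other directions being absorbed in the coefficients. The required cardinal
  function is the restriction of the interpolant of the indicator of the point \<open>t e\<^sub>j\<close> to the line
  through this point.
\<close>

lemma cardinal_coefficients_exist:
  fixes l :: "nat ^ 'd::finite"
  assumes solv: "uniquely_solvable (tensor_kernel \<phi>) l" and t: "t \<in> dyadic (l $ j)"
  shows "\<exists>b. \<forall>s\<in>dyadic (l $ j). kernel_sum_1d \<phi> (l $ j) b s = of_bool (s = t)"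
proof -
  define line :: "real \<Rightarrow> real ^ 'd" where "line s = (\<chi> i. if i = j then s else 0)" for s
  obtain c where
    "interp_coeffs (tensor_kernel \<phi>) l (\<lambda>x. of_bool (x = line t)) c"
    using solv unfolding uniquely_solvable_def by blast
  then have c: "kernel_sum (tensor_kernel \<phi>) l c x = of_bool (x = line t)" if "x \<in> grid l" for x
    using that by (simp add: interp_coeffs_def)
  define a where "a p = c (inv (grid_point l) p) *
    (\<Prod>i\<in>UNIV - {j}. \<phi> (2 ^ (l $ i) * (0 - p $ i)))" for p
  define b where "b y = (\<Sum>p\<in>{p \<in> grid l. p $ j = y}. a p)" for y
  have "kernel_sum_1d \<phi> (l $ j) b s = of_bool (s = t)" if s: "s \<in> dyadic (l $ j)" for s
  proof -
    have "line s \<in> grid l"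
      using s by (auto simp: grid_eq_dyadic line_def zero_in_dyadic)
    then have "of_bool (line s = line t) = kernel_sum (tensor_kernel \<phi>) l c (line s)"
      by (simp add: c)
    also have "\<dots> = (\<Sum>p\<in>grid l. a p * \<phi> (2 ^ (l $ j) * (s - p $ j)))"
      unfolding kernel_sum_tensor_kernel a_def
      by (intro sum.cong refl)
        (simp add: prod.remove[of UNIV j] line_def algebra_simps)
    also have "\<dots> = (\<Sum>y\<in>dyadic (l $ j).
        \<Sum>p\<in>{p \<in> grid l. p $ j = y}. a p * \<phi> (2 ^ (l $ j) * (s - p $ j)))"
      by (rule sum.group[symmetric, OF finite_grid finite_dyadic]) (auto simp: grid_eq_dyadic)
    also have "\<dots> = kernel_sum_1d \<phi> (l $ j) b s"
      by (simp add: kernel_sum_1d_def b_def sum_distrib_right)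
    finally show ?thesis
      by (auto simp: line_def vec_eq_iff of_bool_def split: if_splits)
  qed
  then show ?thesis
    by blast
qed

text \<open>
  The tensor product form satisfies the interpolation conditions and expands into a combination of
  the shifted kernels, so it is the interpolant by uniqueness of the coefficients.
\<close>

lemma kernel_interpolant_cardinal:
  fixes l :: "nat ^ 'd::finite"
  assumes solv: "uniquely_solvable (tensor_kernel \<phi>) l"
    and card: "\<And>j t s. t \<in> dyadic (l $ j) \<Longrightarrow> s \<in> dyadic (l $ j) \<Longrightarrow>
      kernel_sum_1d \<phi> (l $ j) (b (l $ j) t) s = of_bool (s = t)"
  shows "kernel_interpolant (tensor_kernel \<phi>) l u x
    = (\<Sum>p\<in>grid l. u p * (\<Prod>j\<in>UNIV. kernel_sum_1d \<phi> (l $ j) (b (l $ j) (p $ j)) (x $ j)))"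
proof -
  define c where "c = restrict
    (\<lambda>i. \<Sum>p\<in>grid l. u p * (\<Prod>j\<in>UNIV. b (l $ j) (p $ j) (grid_point l i $ j))) (grid_index l)"
  have expand: "kernel_sum (tensor_kernel \<phi>) l c x
      = (\<Sum>p\<in>grid l. u p * (\<Prod>j\<in>UNIV. kernel_sum_1d \<phi> (l $ j) (b (l $ j) (p $ j)) (x $ j)))" for x
  proof -
    have c_inv: "c (inv (grid_point l) y)
        = (\<Sum>p\<in>grid l. u p * (\<Prod>j\<in>UNIV. b (l $ j) (p $ j) (y $ j)))" if "y \<in> grid l" for y
      using that by (auto simp: grid_def c_def inv_f_f[OF inj_grid_point])
    have "kernel_sum (tensor_kernel \<phi>) l c x
        = (\<Sum>y\<in>grid l. \<Sum>p\<in>grid l. u p *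
            (\<Prod>j\<in>UNIV. b (l $ j) (p $ j) (y $ j) * \<phi> (2 ^ (l $ j) * (x $ j - y $ j))))"
      by (simp add: kernel_sum_tensor_kernel c_inv sum_distrib_right prod.distrib mult.assoc)
    also have "\<dots> = (\<Sum>p\<in>grid l. u p * (\<Sum>y\<in>grid l.
            \<Prod>j\<in>UNIV. b (l $ j) (p $ j) (y $ j) * \<phi> (2 ^ (l $ j) * (x $ j - y $ j))))"
      by (subst sum.swap) (simp add: sum_distrib_left)
    also have "\<dots> = (\<Sum>p\<in>grid l. u p *
        (\<Prod>j\<in>UNIV. kernel_sum_1d \<phi> (l $ j) (b (l $ j) (p $ j)) (x $ j)))"
      unfolding grid_eq_dyadic[of l] kernel_sum_1d_def
      by (simp only: sum_vec_prod[OF finite_dyadic,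
            where f = "\<lambda>j y. b (l $ j) (_ $ j) y * \<phi> (2 ^ (l $ j) * (x $ j - y))"])
    finally show ?thesis .
  qed
  have "interp_coeffs (tensor_kernel \<phi>) l u c"
    unfolding interp_coeffs_def
  proof (intro conjI ballI)
    show "c \<in> extensional (grid_index l)"
      by (simp add: c_def)
    fix x
    assume x: "x \<in> grid l"
    have "kernel_sum (tensor_kernel \<phi>) l c x = (\<Sum>p\<in>grid l. u p * of_bool (x = p))"
      unfolding expand
    proof (intro sum.cong refl arg_cong2[where f = "(*)"])
      fix p
      assume "p \<in> grid l"
      then have "(\<Prod>j\<in>UNIV. kernel_sum_1d \<phi> (l $ j) (b (l $ j) (p $ j)) (x $ j))
          = (\<Prod>j\<in>UNIV. of_bool (x $ j = p $ j))"
        using x by (intro prod.cong refl card) (auto simp: grid_eq_dyadic)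
      then show "(\<Prod>j\<in>UNIV. kernel_sum_1d \<phi> (l $ j) (b (l $ j) (p $ j)) (x $ j)) = of_bool (x = p)"
        by (auto simp: prod_of_bool vec_eq_iff)
    qed
    also have "\<dots> = u x"
      using x by (simp add: finite_grid of_bool_def if_distrib cong: if_cong)
    finally show "kernel_sum (tensor_kernel \<phi>) l c x = u x" .
  qed
  then have "(THE c. interp_coeffs (tensor_kernel \<phi>) l u c) = c"
    using solv by (auto simp: uniquely_solvable_def intro: the1_equality)
  then show ?thesis
    by (simp add: kernel_interpolant_def expand)
qed

text \<open>
  Extend the cardinal functions by zero to nodes outside their level, so that the interpolants of
  level \<open>l\<close> and of its truncation become sums over the same grid. Their terms agree at a point of
  \<open>grid k\<close>: a direction with \<open>l $ j > k $ j\<close> contributes a Kronecker delta at either level.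
\<close>

lemma kernel_interpolant_truncate:
  fixes k l :: "nat ^ 'd::finite"
  assumes solv: "\<forall>l :: nat ^ 'd. (\<forall>j. 1 \<le> l $ j) \<longrightarrow> uniquely_solvable (tensor_kernel \<phi>) l"
    and x: "x \<in> grid k" and k: "\<forall>j. 1 \<le> k $ j" and l: "\<forall>j. 1 \<le> l $ j"
  shows "kernel_interpolant (tensor_kernel \<phi>) l u x
    = kernel_interpolant (tensor_kernel \<phi>) (\<chi> j. min (l $ j) (k $ j)) u x"
proof -
  have "\<exists>b. \<forall>s\<in>dyadic L. kernel_sum_1d \<phi> L b s = of_bool (s = t)"
    if "1 \<le> L" "t \<in> dyadic L" for L t
    using cardinal_coefficients_exist[of \<phi> "\<chi> _ :: 'd. L"] solv that by simp
  then obtain b where b: "\<And>L t s. 1 \<le> L \<Longrightarrow> t \<in> dyadic L \<Longrightarrow> s \<in> dyadic L \<Longrightarrow>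
      kernel_sum_1d \<phi> L (b L t) s = of_bool (s = t)"
    by metis
  define w where "w L t s = (if t \<in> dyadic L then kernel_sum_1d \<phi> L (b L t) s else 0)" for L t s
  have w_node: "w L t s = of_bool (s = t)" if "1 \<le> L" "s \<in> dyadic L" for L t s
    using that by (auto simp: w_def b)
  have sum_w: "kernel_interpolant (tensor_kernel \<phi>) l' u x
      = (\<Sum>p\<in>grid l. u p * (\<Prod>j\<in>UNIV. w (l' $ j) (p $ j) (x $ j)))"
    if l': "\<forall>j. 1 \<le> l' $ j" "\<forall>j. l' $ j \<le> l $ j" for l' :: "nat ^ 'd"
  proof -
    have "kernel_interpolant (tensor_kernel \<phi>) l' u x
      = (\<Sum>p\<in>grid l'. u p *
          (\<Prod>j\<in>UNIV. kernel_sum_1d \<phi> (l' $ j) (b (l' $ j) (p $ j)) (x $ j)))"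
      using solv l' by (intro kernel_interpolant_cardinal b) auto
    also have "\<dots> = (\<Sum>p\<in>grid l. u p * (\<Prod>j\<in>UNIV. w (l' $ j) (p $ j) (x $ j)))"
    proof (rule sum.mono_neutral_cong_left[OF finite_grid])
      show "grid l' \<subseteq> grid l"
        using dyadic_mono l' by (fastforce simp: grid_eq_dyadic)
      show "\<forall>p\<in>grid l - grid l'. u p * (\<Prod>j\<in>UNIV. w (l' $ j) (p $ j) (x $ j)) = 0"
        by (auto simp: grid_eq_dyadic w_def)
    qed (simp add: grid_eq_dyadic w_def)
    finally show ?thesis .
  qed
  have "w (min (l $ j) (k $ j)) t (x $ j) = w (l $ j) t (x $ j)" for j t
  proof (cases "l $ j \<le> k $ j")
    case False
    have "x $ j \<in> dyadic (k $ j)"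
      using x by (simp add: grid_eq_dyadic)
    moreover from this have "x $ j \<in> dyadic (l $ j)"
      using False dyadic_mono[of "k $ j" "l $ j"] by auto
    ultimately show ?thesis
      using False k l by (simp add: w_node)
  qed simp
  then show ?thesis
    using k l by (simp add: sum_w)
qed

section \<open>Interpolation on the sparse grid\<close>

theorem theorem1:
  fixes \<phi> :: "real \<Rightarrow> real"
  assumes "CARD('d::finite) \<ge> 2"
    and "\<forall>l :: nat ^ 'd. (\<forall>j. 1 \<le> l $ j) \<longrightarrow> uniquely_solvable (tensor_kernel \<phi>) l"
  shows "\<forall>n\<ge>1. \<forall>u :: real ^ 'd \<Rightarrow> real. \<forall>x\<in>sparse_grid n.
    sparse_kernel_interpolant (tensor_kernel \<phi>) n u x = u x"
proof (intro allI impI ballI)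
  fix n :: nat and u :: "real ^ 'd \<Rightarrow> real" and x :: "real ^ 'd"
  assume "x \<in> sparse_grid n"
  then obtain k where k: "k \<in> levels (n + (CARD('d) - 1))" and x: "x \<in> grid k"
    by (auto simp: sparse_grid_def)
  have pos: "\<forall>j. 1 \<le> k $ j"
    using k by (simp add: levels_def)
  have "sparse_kernel_interpolant (tensor_kernel \<phi>) n u x = kernel_interpolant (tensor_kernel \<phi>) k u x"
    unfolding sparse_kernel_interpolant_def
    by (rule combination_sum_truncated[OF k, where F = "\<lambda>l. kernel_interpolant (tensor_kernel \<phi>) l u x",
          OF kernel_interpolant_truncate[OF assms(2) x pos]])
  also have "\<dots> = u x"
    using assms(2) pos x by (simp add: kernel_interpolant_interpolates)
  finally show "sparse_kernel_interpolant (tensor_kernel \<phi>) n u x = u x" .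
qed

end
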